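(* Suppose $\mathbf n$ has $l$-bounded quotient gaps, and the basis $\mathcal B$ of $\mathbb X$ is $\mathbf K_{suc}$-$\mathbf n$-suppression unconditional for constant coefficients. Then $\mathcal B$ is $\mathbf C$-suppression unconditional for constant coefficients, with $$\mathbf C\le\max\{(n_1-1)\alpha_1\alpha_2,\ l\,\mathbf K_{suc}\}.$$
   Context: $\mathbb X$ is a separable infinite-dimensional Banach space over $\mathbb F=\mathbb R$ or $\mathbb C$, with dual $\mathbb X^*$. A basis of $\mathbb X$ is a sequence $\mathcal B=(\mathbf e_i)_{i\in\mathbb N}\subset\mathbb X$ with closed linear span $\mathbb X$, having a (unique) sequence of biorthogonal functionals $(\mathbf e_i^* )_{i\in\mathbb N}\subset\mathbb X^*$ ($\mathbf e_k^*(\mathbf e_i)=\delta_{k,i}$), with $0<\inf_i\min\{\|\mathbf e_i\|,\|\mathbf e_i^*\|\}\le\sup_i\max\{\|\mathbf e_i\|,\|\mathbf e_i^*\|\}<\infty$. Put $\alpha_1=\sup_i\|\mathbf e_i\|$, $\alpha_2=\sup_i\|\mathbf e_i^*\|$. $\mathbf n=(n_k)_{k\in\mathbb N}$ is a strictly increasing sequence of positive integers, also regarded as a subset of $\mathbb N$ ($\mathbf n=\mathbb N$ is allowed). For an integer $l\ge2$, $\mathbf n$ has $l$-bounded quotient gaps if $n_{k+1}/n_k\le l$ for all $k$. For a finite $A\subset\mathbb N$, $\Psi_A$ is the set of families $\varepsilon=(\varepsilon_n)_{n\in A}\subset\mathbb F$ with $|\varepsilon_n|=1$, and $\mathbf 1_{\varepsilon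 A}=\sum_{n\in A}\varepsilon_n\mathbf e_n$; if $A\subset B$ and $\varepsilon\in\Psi_B$, then $\mathbf 1_{\varepsilon A}$ is formed with the restriction of $\varepsilon$ to $A$. $\mathcal B$ is $\mathbf n$-suppression unconditional for constant coefficients if there is $\mathbf C>0$ with $\|\mathbf 1_{\varepsilon A}\|\le\mathbf C\|\mathbf 1_{\varepsilon B}\|$ for all finite $A\subset B\subset\mathbb N$ with $|A|\in\mathbf n$ and all $\varepsilon\in\Psi_B$. It is $\mathbf K_{suc}$-$\mathbf n$-suppression unconditional for constant coefficients if $\mathbf K_{suc}$ is the smallest such constant. The prefix $\mathbf n$ is omitted when $\mathbf n=\mathbb N$. *)

theory Defs
  imports "HOL-Analysis.Analysis"
begin

text \<open>
  The scalar field is \<open>\<real>\<close> or \<open>\<complex>\<close>: a type whose elements embed into \<^typ>\<open>complex\<close>, isometrically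
  and compatibly with the field structure, with image \<open>\<real>\<close> or all of \<open>\<complex>\<close>.
\<close>

class real_or_complex = real_normed_field +
  assumes embeds_complex:
    "\<exists>\<phi> :: 'a \<Rightarrow> complex.
       \<phi> 1 = 1 \<and> (\<forall>x y. \<phi> (x + y) = \<phi> x + \<phi> y) \<and> (\<forall>x y. \<phi> (x * y) = \<phi> x * \<phi> y) \<and>
       (\<forall>x. norm (\<phi> x) = norm x) \<and> (range \<phi> = \<real> \<or> range \<phi> = UNIV)"

instance real :: real_or_complex
  by standard (rule exI[of _ complex_of_real], auto simp: Reals_def)

instance complex :: real_or_complex
  by standard (rule exI[of _ "\<lambda>z. z"], simp)

text \<open>
  A Banach space over the scalar type \<^typ>\<open>'f\<close>. The class \<^class>\<open>banach\<close> only provides the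
  underlying real Banach space; \<open>smul\<close> is the scalar multiplication by \<^typ>\<open>'f\<close> extending it.
\<close>

locale banach_space_over = vector_space smul
  for smul :: "'f::real_or_complex \<Rightarrow> 'x::banach \<Rightarrow> 'x" +
  assumes scale_of_real: "smul (of_real r) x = r *\<^sub>R x"
    and norm_scale: "norm (smul c x) = norm c * norm x"

definition infinite_dimensional :: "('f::real_or_complex \<Rightarrow> 'x::banach \<Rightarrow> 'x) \<Rightarrow> bool"
  where "infinite_dimensional smul \<longleftrightarrow> \<not> (\<exists>S. finite S \<and> module.span smul S = UNIV)"

text \<open>
  Elements of \<^typ>\<open>'x \<Rightarrow>\<^sub>L 'f\<close> are bounded and real-linear; the dual space consists of the
  \<^typ>\<open>'f\<close>-linear ones.
\<close>

definition dual_space ::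
  "('f::real_or_complex \<Rightarrow> 'x::banach \<Rightarrow> 'x) \<Rightarrow> ('x \<Rightarrow>\<^sub>L 'f) set"
  where "dual_space smul = {f. \<forall>c x. blinfun_apply f (smul c x) = c * blinfun_apply f x}"

text \<open>
  The biorthogonal functionals are a parameter; they are uniquely determined by \<open>e\<close>, as its
  span is dense.  The index set is \<^typ>\<open>nat\<close>, starting at 0.
\<close>

definition is_basis ::
  "('f::real_or_complex \<Rightarrow> 'x::banach \<Rightarrow> 'x) \<Rightarrow> (nat \<Rightarrow> 'x) \<Rightarrow> (nat \<Rightarrow> 'x \<Rightarrow>\<^sub>L 'f) \<Rightarrow> bool"
  where "is_basis smul e e_dual \<longleftrightarrow>
    closure (module.span smul (range e)) = UNIV \<and>
    range e_dual \<subseteq> dual_space smul \<and>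
    (\<forall>k i. blinfun_apply (e_dual k) (e i) = (if k = i then 1 else 0)) \<and>
    0 < (INF i. min (norm (e i)) (norm (e_dual i))) \<and>
    bdd_above (range (\<lambda>i. max (norm (e i)) (norm (e_dual i))))"

definition bounded_quotient_gaps :: "nat \<Rightarrow> (nat \<Rightarrow> nat) \<Rightarrow> bool"
  where "bounded_quotient_gaps l n \<longleftrightarrow> (\<forall>k. real (n (Suc k)) / real (n k) \<le> real l)"

text \<open>\<open>\<Psi>\<^sub>A\<close>: only the values of \<open>\<epsilon>\<close> on \<open>A\<close> are relevant, so restriction to a subset is implicit.\<close>

definition unit_signs :: "nat set \<Rightarrow> (nat \<Rightarrow> 'f::real_or_complex) set"
  where "unit_signs A = {\<epsilon>. \<forall>i\<in>A. norm (\<epsilon> i) = 1}"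

definition signed_indicator ::
  "('f::real_or_complex \<Rightarrow> 'x::banach \<Rightarrow> 'x) \<Rightarrow> (nat \<Rightarrow> 'x) \<Rightarrow> (nat \<Rightarrow> 'f) \<Rightarrow> nat set \<Rightarrow> 'x"
  where "signed_indicator smul e \<epsilon> A = (\<Sum>i\<in>A. smul (\<epsilon> i) (e i))"

definition suc_constants ::
  "('f::real_or_complex \<Rightarrow> 'x::banach \<Rightarrow> 'x) \<Rightarrow> (nat \<Rightarrow> 'x) \<Rightarrow> nat set \<Rightarrow> real set"
  where "suc_constants smul e N =
    {C. 0 < C \<and>
        (\<forall>A B. \<forall>\<epsilon>\<in>unit_signs B.
           finite B \<longrightarrow> A \<subseteq> B \<longrightarrow> card A \<in> N \<longrightarrow>
             norm (signed_indicator smul e \<epsilon> A) \<le> C * norm (signed_indicator smul e \<epsilon> B))}"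

text \<open>\<open>K\<close>-\<open>N\<close>-suppression unconditional for constant coefficients: \<open>K\<close> is the smallest constant.\<close>

definition N_suppression_unconditional_cc ::
  "('f::real_or_complex \<Rightarrow> 'x::banach \<Rightarrow> 'x) \<Rightarrow> (nat \<Rightarrow> 'x) \<Rightarrow> nat set \<Rightarrow> real \<Rightarrow> bool"
  where "N_suppression_unconditional_cc smul e N K \<longleftrightarrow>
    K \<in> suc_constants smul e N \<and> (\<forall>C\<in>suc_constants smul e N. K \<le> C)"

definition suppression_unconditional_cc ::
  "('f::real_or_complex \<Rightarrow> 'x::banach \<Rightarrow> 'x) \<Rightarrow> (nat \<Rightarrow> 'x) \<Rightarrow> real \<Rightarrow> bool"
  where "suppression_unconditional_cc smul e C \<longleftrightarrow>
    N_suppression_unconditional_cc smul e {1..} C"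

end

theory Submission
  imports Defs
begin

text \<open>
  Let \<open>A \<subseteq> B\<close> with \<open>m = |A| \<ge> 1\<close>. Small and large \<open>m\<close> are treated by different
  means, which is where the two terms of the maximum come from.

  If \<open>m < n\<^sub>1\<close> (the entry \<open>n 0\<close>), nothing is known about suppression, but the triangle
  inequality gives \<open>\<parallel>1\<^sub>\<epsilon>\<^sub>A\<parallel> \<le> (n\<^sub>1 - 1) \<alpha>\<^sub>1\<close>, and applying one biorthogonal functional with index
  in \<open>A\<close> gives \<open>1 \<le> \<alpha>\<^sub>2 \<parallel>1\<^sub>\<epsilon>\<^sub>B\<parallel>\<close> (\<open>norm_signed_indicator_le\<close>,
  \<open>norm_signed_indicator_ge\<close>).

  If \<open>m \<ge> n\<^sub>1\<close>, then \<open>m\<close> lies between two consecutive entries, \<open>n\<^sub>k \<le> m < n\<^sub>k\<^sub>+\<^sub>1\<close>, and the gap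
  condition yields \<open>m \<le> l n\<^sub>k\<close>. The vector \<open>1\<^sub>\<epsilon>\<^sub>A\<close> is \<open>m / n\<^sub>k\<close> times the average of the
  \<open>1\<^sub>\<epsilon>\<^sub>D\<close> over all \<open>D \<subseteq> A\<close> of cardinality \<open>n\<^sub>k\<close>, and each of these has norm at most
  \<open>K \<parallel>1\<^sub>\<epsilon>\<^sub>B\<parallel>\<close>. Hence \<open>\<parallel>1\<^sub>\<epsilon>\<^sub>A\<parallel> \<le> (m / n\<^sub>k) K \<parallel>1\<^sub>\<epsilon>\<^sub>B\<parallel> \<le> l K \<parallel>1\<^sub>\<epsilon>\<^sub>B\<parallel>\<close>
  (\<open>norm_sum_le_of_subsets\<close>).

  So the maximum is an admissible constant, and it remains to see that admissible constants
  have a smallest element (\<open>least_suppression_constant\<close>).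
\<close>

text \<open>
  The averaging argument. Instead of counting the \<open>k\<close>-subsets through each point, the
  cardinality is lowered by one at a time: every point of \<open>A\<close> is missed by exactly one of the
  sets \<open>A - {i}\<close>, so \<open>(|A| - 1) \<Sum>\<^sub>A f = \<Sum>\<^sub>i \<Sum>\<^bsub>A - {i}\<^esub> f\<close>.
\<close>

lemma norm_sum_le_of_subsets:
  fixes f :: "'i \<Rightarrow> 'x::real_normed_vector"
  assumes "finite A" and "0 < k" and "k \<le> card A"
    and "\<And>D. D \<subseteq> A \<Longrightarrow> card D = k \<Longrightarrow> norm (sum f D) \<le> M"
  shows "real k * norm (sum f A) \<le> real (card A) * M"
  using assms
proof (induction "card A" arbitrary: A)
  case 0
  then show ?case by simp
next
  case (Suc m)
  show ?case
  proof (cases "k = Suc m")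
    case True
    then have "norm (sum f A) \<le> M"
      using Suc.prems(4)[of A] Suc.hyps(2) by simp
    then show ?thesis
      using True Suc.hyps(2) by (simp add: mult_left_mono)
  next
    case False
    then have km: "k \<le> m" using Suc.prems Suc.hyps(2) by simp
    then have m0: "0 < m" using \<open>0 < k\<close> by simp
    have removed: "real k * norm (sum f (A - {i})) \<le> real m * M" if "i \<in> A" for i
    proof -
      have c: "m = card (A - {i})"
        using that Suc.hyps(2) Suc.prems(1) by simp
      have "norm (sum f D) \<le> M" if "D \<subseteq> A - {i}" "card D = k" for D
        using that Suc.prems(4) by blast
      then show ?thesis
        using Suc.hyps(1)[OF c] Suc.prems(1,2) km c by simp
    qed
    have "(\<Sum>i\<in>A. sum f (A - {i})) = (\<Sum>i\<in>A. sum f A - f i)"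
      using Suc.prems(1) by (intro sum.cong) (auto simp: sum_diff1)
    also have "\<dots> = real (card A) *\<^sub>R sum f A - sum f A"
      by (simp add: sum_subtractf sum_constant_scaleR)
    also have "\<dots> = real m *\<^sub>R sum f A"
      by (simp add: Suc.hyps(2)[symmetric] algebra_simps)
    finally have avg: "real m *\<^sub>R sum f A = (\<Sum>i\<in>A. sum f (A - {i}))" ..
    have "real m * (real k * norm (sum f A)) = real k * norm (real m *\<^sub>R sum f A)"
      by simp
    also have "\<dots> \<le> real k * (\<Sum>i\<in>A. norm (sum f (A - {i})))"
      unfolding avg by (intro mult_left_mono norm_sum) simp
    also have "\<dots> \<le> (\<Sum>i\<in>A. real m * M)"
      unfolding sum_distrib_left by (intro sum_mono removed)
    also have "\<dots> = real m * (real (card A) * M)"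
      by simp
    finally show ?thesis
      using m0 by simp
  qed
qed

lemma (in banach_space_over) norm_signed_indicator_le:
  assumes "\<epsilon> \<in> unit_signs A" and "\<And>i. norm (e i) \<le> \<alpha>"
  shows "norm (signed_indicator smul e \<epsilon> A) \<le> real (card A) * \<alpha>"
  unfolding signed_indicator_def
proof (rule sum_norm_bound)
  fix i assume "i \<in> A"
  then show "norm (smul (\<epsilon> i) (e i)) \<le> \<alpha>"
    using assms by (simp add: norm_scale unit_signs_def)
qed

lemma norm_signed_indicator_ge:
  assumes "is_basis smul e e_dual" and "\<epsilon> \<in> unit_signs B" and "finite B" and "j \<in> B"
  shows "1 \<le> norm (e_dual j) * norm (signed_indicator smul e \<epsilon> B)"
proof -
  have lin: "blinfun_apply (e_dual j) (smul c x) = c * blinfun_apply (e_dual j) x" for c x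
    using assms(1) unfolding is_basis_def dual_space_def by blast
  have bi: "blinfun_apply (e_dual j) (e i) = (if j = i then 1 else 0)" for i
    using assms(1) unfolding is_basis_def by blast
  have "blinfun_apply (e_dual j) (signed_indicator smul e \<epsilon> B) = \<epsilon> j"
    using assms(3,4) unfolding signed_indicator_def
    by (simp add: blinfun.sum_right lin bi if_distrib cong: if_cong)
  then have "1 = norm (blinfun_apply (e_dual j) (signed_indicator smul e \<epsilon> B))"
    using assms(2,4) by (simp add: unit_signs_def)
  also have "\<dots> \<le> norm (e_dual j) * norm (signed_indicator smul e \<epsilon> B)"
    by (rule norm_blinfun)
  finally show ?thesis .
qed

lemma suc_constantsD:
  assumes "C \<in> suc_constants smul e N"
    and "\<epsilon> \<in> unit_signs B" and "finite B" and "A \<subseteq> B" and "card A \<in> N"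
  shows "norm (signed_indicator smul e \<epsilon> A) \<le> C * norm (signed_indicator smul e \<epsilon> B)"
  using assms unfolding suc_constants_def by blast

text \<open>
  The admissible constants are cut out by the closed conditions \<open>a \<le> C b\<close> together with the open
  condition \<open>0 < C\<close>. Taking \<open>A = B\<close> a singleton forces \<open>C \<ge> 1\<close>, so the infimum stays away from
  \<open>0\<close> and is itself admissible.
\<close>

lemma least_suppression_constant:
  assumes "is_basis smul e e_dual" and mem: "C \<in> suc_constants smul e {1..}"
  obtains C\<^sub>0 where "suppression_unconditional_cc smul e C\<^sub>0" and "C\<^sub>0 \<le> C"
proof -
  let ?S = "suc_constants smul e {1..}"
  have ge1: "1 \<le> D" if "D \<in> ?S" for D
  proof -
    let ?v = "signed_indicator smul e (\<lambda>_. 1) {0}"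
    have "1 \<le> norm (e_dual 0) * norm ?v"
      by (rule norm_signed_indicator_ge[OF assms(1)]) (auto simp: unit_signs_def)
    then have "0 < norm ?v" by (cases "?v = 0") auto
    moreover have "norm ?v \<le> D * norm ?v"
      by (rule suc_constantsD[OF that]) (auto simp: unit_signs_def)
    ultimately show ?thesis by simp
  qed
  have bdd: "bdd_below ?S" using ge1 by (rule bdd_belowI)
  have "0 < Inf ?S"
  proof -
    have "1 \<le> Inf ?S" using mem ge1 by (intro cInf_greatest) auto
    then show ?thesis by simp
  qed
  moreover have "norm (signed_indicator smul e \<epsilon> A) \<le> Inf ?S * norm (signed_indicator smul e \<epsilon> B)"
    if AB: "\<epsilon> \<in> unit_signs B" "finite B" "A \<subseteq> B" "card A \<in> {1..}" for A B \<epsilon>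
  proof -
    let ?a = "norm (signed_indicator smul e \<epsilon> A)" and ?b = "norm (signed_indicator smul e \<epsilon> B)"
    have le: "?a \<le> D * ?b" if "D \<in> ?S" for D
      using that AB by (rule suc_constantsD)
    show ?thesis
    proof (cases "?b = 0")
      case True
      then show ?thesis using le[OF mem] by simp
    next
      case False
      then have pos: "0 < ?b" by simp
      then have "?a / ?b \<le> Inf ?S"
        using mem le by (intro cInf_greatest) (auto simp: pos_divide_le_eq)
      then show ?thesis using pos by (simp add: pos_divide_le_eq)
    qed
  qed
  ultimately have "Inf ?S \<in> ?S"
    unfolding suc_constants_def[of smul e] by blast
  moreover have "Inf ?S \<le> D" if "D \<in> ?S" for D
    using that bdd by (rule cInf_lower)
  ultimately show ?thesis
    using that[of "Inf ?S"] mem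
    unfolding suppression_unconditional_cc_def N_suppression_unconditional_cc_def by blast
qed

lemma strict_mono_nat_interval:
  fixes n :: "nat \<Rightarrow> nat"
  assumes "strict_mono n" and "n 0 \<le> m"
  obtains k where "n k \<le> m" and "m < n (Suc k)"
proof -
  have "m < n (Suc m)"
    using strict_mono_imp_increasing[OF assms(1), of "Suc m"] by simp
  then obtain k where "\<forall>i\<le>k. \<not> m < n i" "m < n (Suc k)"
    using ex_least_nat_less[of "\<lambda>i. m < n i" "Suc m"] assms(2) by auto
  then show ?thesis using that by (meson le_refl not_less)
qed

theorem proposition4p5:
  fixes smul :: "'f::real_or_complex \<Rightarrow> 'x::banach \<Rightarrow> 'x"
    and e :: "nat \<Rightarrow> 'x" and e_dual :: "nat \<Rightarrow> 'x \<Rightarrow>\<^sub>L 'f"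
    and n :: "nat \<Rightarrow> nat" and l :: nat
    and \<alpha>\<^sub>1 \<alpha>\<^sub>2 K :: real
  assumes "banach_space_over smul"
    and "separable_space (euclidean :: 'x topology)"
    and "infinite_dimensional smul"
    and "is_basis smul e e_dual"
    and "\<alpha>\<^sub>1 = (SUP i. norm (e i))"
    and "\<alpha>\<^sub>2 = (SUP i. norm (e_dual i))"
    and "strict_mono n" and "\<forall>k. 0 < n k"
    and "2 \<le> l" and "bounded_quotient_gaps l n"
    and "N_suppression_unconditional_cc smul e (range n) K"
  shows "\<exists>C. suppression_unconditional_cc smul e C \<and>
             C \<le> max ((real (n 0) - 1) * \<alpha>\<^sub>1 * \<alpha>\<^sub>2) (real l * K)"
proof -
  interpret banach_space_over smul by fact
  have "bdd_above (range (\<lambda>i. max (norm (e i)) (norm (e_dual i))))"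
    using assms(4) unfolding is_basis_def by (elim conjE)
  then obtain M where M: "\<And>i. max (norm (e i)) (norm (e_dual i)) \<le> M"
    by (auto simp: bdd_above_def)
  then have "bdd_above (range (\<lambda>i. norm (e i)))" "bdd_above (range (\<lambda>i. norm (e_dual i)))"
    by (auto intro!: bdd_aboveI[where M = M])
  then have \<alpha>\<^sub>1: "norm (e i) \<le> \<alpha>\<^sub>1" and \<alpha>\<^sub>2: "norm (e_dual i) \<le> \<alpha>\<^sub>2" for i
    unfolding assms(5,6) by (auto intro: cSUP_upper)
  have \<alpha>\<^sub>1_nonneg: "0 \<le> \<alpha>\<^sub>1" using \<alpha>\<^sub>1[of 0] norm_ge_zero[of "e 0"] by linarith
  have K: "K \<in> suc_constants smul e (range n)"
    using assms(11) unfolding N_suppression_unconditional_cc_def by blast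
  then have K_pos: "0 < K" unfolding suc_constants_def by blast
  let ?C = "max ((real (n 0) - 1) * \<alpha>\<^sub>1 * \<alpha>\<^sub>2) (real l * K)"
  have "?C \<in> suc_constants smul e {1..}"
    unfolding suc_constants_def mem_Collect_eq
  proof (intro conjI allI ballI impI)
    show "0 < ?C" using K_pos assms(9) by (simp add: less_max_iff_disj)
  next
    fix A B and \<epsilon> :: "nat \<Rightarrow> 'f"
    assume \<epsilon>: "\<epsilon> \<in> unit_signs B" and B: "finite B" and AB: "A \<subseteq> B" and A: "card A \<in> {1..}"
    let ?a = "norm (signed_indicator smul e \<epsilon> A)" and ?b = "norm (signed_indicator smul e \<epsilon> B)"
    have finA: "finite A" using AB B by (rule finite_subset)
    have "?a \<le> (real (n 0) - 1) * \<alpha>\<^sub>1 * \<alpha>\<^sub>2 * ?b \<or> ?a \<le> real l * K * ?b"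
    proof (cases "card A < n 0")
      case True
      obtain j where j: "j \<in> B" using A AB by fastforce
      have "1 \<le> norm (e_dual j) * ?b"
        by (rule norm_signed_indicator_ge[OF assms(4) \<epsilon> B j])
      also have "\<dots> \<le> \<alpha>\<^sub>2 * ?b" by (simp add: \<alpha>\<^sub>2 mult_right_mono)
      finally have one: "1 \<le> \<alpha>\<^sub>2 * ?b" .
      have "\<epsilon> \<in> unit_signs A" using \<epsilon> AB unfolding unit_signs_def by blast
      then have "?a \<le> real (card A) * \<alpha>\<^sub>1"
        using \<alpha>\<^sub>1 by (rule norm_signed_indicator_le)
      also have "\<dots> \<le> (real (n 0) - 1) * \<alpha>\<^sub>1"
        using True \<alpha>\<^sub>1_nonneg by (intro mult_right_mono) auto
      also have "\<dots> \<le> (real (n 0) - 1) * \<alpha>\<^sub>1 * (\<alpha>\<^sub>2 * ?b)"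
        using mult_left_mono[OF one, of "(real (n 0) - 1) * \<alpha>\<^sub>1"] True \<alpha>\<^sub>1_nonneg by simp
      finally show ?thesis by (simp add: mult.assoc)
    next
      case False
      then have "n 0 \<le> card A" by simp
      then obtain k where k: "n k \<le> card A" "card A < n (Suc k)"
        by (rule strict_mono_nat_interval[OF assms(7)])
      have nk: "0 < n k" using assms(8) by blast
      have "real (n (Suc k)) / real (n k) \<le> real l"
        using assms(10) unfolding bounded_quotient_gaps_def by blast
      then have "real (n (Suc k)) \<le> real l * real (n k)"
        using nk by (simp add: pos_divide_le_eq)
      then have card: "real (card A) \<le> real l * real (n k)" using k(2) by linarith
      have "norm (\<Sum>i\<in>D. smul (\<epsilon> i) (e i)) \<le> K * ?b" if D: "D \<subseteq> A" "card D = n k" for D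
      proof -
        have "D \<subseteq> B" "card D \<in> range n" using D AB by auto
        then have "norm (signed_indicator smul e \<epsilon> D) \<le> K * ?b"
          by (rule suc_constantsD[OF K \<epsilon> B])
        then show ?thesis unfolding signed_indicator_def[of _ _ _ D] .
      qed
      then have "real (n k) * norm (\<Sum>i\<in>A. smul (\<epsilon> i) (e i)) \<le> real (card A) * (K * ?b)"
        by (rule norm_sum_le_of_subsets[OF finA nk k(1)])
      then have "real (n k) * ?a \<le> real (card A) * (K * ?b)"
        unfolding signed_indicator_def[of _ _ _ A] .
      also have "\<dots> \<le> real l * real (n k) * (K * ?b)"
        using K_pos by (intro mult_right_mono card) simp
      finally have "real (n k) * ?a \<le> real (n k) * (real l * K * ?b)"
        by (simp add: mult_ac)
      then show ?thesis using nk by simp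
    qed
    moreover have "x * ?b \<le> ?C * ?b" if "x \<le> ?C" for x
      using that by (rule mult_right_mono) simp
    ultimately show "?a \<le> ?C * ?b"
      by (meson max.cobounded1 max.cobounded2 order_trans)
  qed
  then obtain C where "suppression_unconditional_cc smul e C" "C \<le> ?C"
    by (rule least_suppression_constant[OF assms(4)])
  then show ?thesis by blast
qed

end
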